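(* Let $k,\ell\ge 3$ and let $b_1,\dots,b_{k-1},c_1,\dots,c_{\ell-1}\in\mathbb{Z}^+$ with $b_1=\min(b_1,\dots,b_{k-1})$ and $c_1=\min(c_1,\dots,c_{\ell-1})$. Let $\mathcal{E}_k$ be the equation $b_1x_1+\cdots+b_{k-1}x_{k-1}-x_k=0$ and let $\mathcal{E}_\ell$ be the equation $c_1x_1+\cdots+c_{\ell-1}x_{\ell-1}-x_\ell=0$. Assume that $t=b_1=c_1$. Let $q=\sum_{i=2}^{k-1}b_i$ and $s=\sum_{i=2}^{\ell-1}c_i$, and (without loss of generality) let $q\ge s$. Then $$RR(\mathcal{E}_k,\mathcal{E}_\ell)\ \ge\ t(t+q)(t+s)+s.$$
   Context: For two linear homogeneous equations $\mathcal{E},\mathcal{E}'$ with integer coefficients, each in at least three variables, $RR(\mathcal{E},\mathcal{E}')$ denotes the minimum integer $N$, if it exists, such that any $2$-coloring of $[1,N]=\{1,2,\dots,N\}$ admits either a solution to $\mathcal{E}$ with all entries in $[1,N]$ and of the first color, or a solution to $\mathcal{E}'$ with all entries in $[1,N]$ and of the second color. Entries of solutions need not be distinct. *)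

theory Defs
  imports Main "HOL-Library.Extended_Nat"
begin

text \<open>
  A linear homogeneous equation with integer coefficients is represented by its list of
  coefficients; the number of variables is the length of the list.
\<close>

definition is_solution :: "int list \<Rightarrow> nat list \<Rightarrow> bool" where
  "is_solution E x \<longleftrightarrow> length x = length E \<and> (\<Sum>i<length E. E ! i * int (x ! i)) = 0"

definition has_solution_in :: "int list \<Rightarrow> nat set \<Rightarrow> bool" where
  "has_solution_in E A \<longleftrightarrow> (\<exists>x. is_solution E x \<and> set x \<subseteq> A)"

text \<open>
  The first colour is \<^term>\<open>True\<close>, the second is \<^term>\<open>False\<close>. Colours given outside
  \<open>{1..N}\<close> play no role.
\<close>

definition RR_property :: "int list \<Rightarrow> int list \<Rightarrow> nat \<Rightarrow> bool" where
  "RR_property E E' N \<longleftrightarrow>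
     (\<forall>\<chi> :: nat \<Rightarrow> bool.
        has_solution_in E {n \<in> {1..N}. \<chi> n} \<or>
        has_solution_in E' {n \<in> {1..N}. \<not> \<chi> n})"

text \<open>
  The infimum in \<^typ>\<open>enat\<close> is the minimum whenever some \<open>N\<close> has the property, and
  \<open>\<infinity>\<close> when the number does not exist.
\<close>

definition RR :: "int list \<Rightarrow> int list \<Rightarrow> enat" where
  "RR E E' = Inf {enat N | N. RR_property E E' N}"

text \<open>The equation \<open>b 1 * x\<^sub>1 + \<dots> + b (k - 1) * x\<^bsub>k - 1\<^esub> - x\<^sub>k = 0\<close>.\<close>

definition rado_eq :: "nat \<Rightarrow> (nat \<Rightarrow> nat) \<Rightarrow> int list" where
  "rado_eq k b = map (\<lambda>i. int (b i)) [1..<k] @ [- 1]"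

end

(* Colour {1..<t+s} and everything from (t+s)(t+q) on with the second colour, and the interval
   in between with the first. A sum with coefficients b of numbers of the first colour is too
   large to have the first colour. A sum with coefficients c of numbers below t + s is at least
   t + s and at most (t+s)(t+s-1) < (t+s)(t+q), which is where s \<le> q enters; if some summand is
   at least (t+s)(t+q), then the sum is at least t(t+s)(t+q) + s, because every coefficient is
   at least t. *)

theory Submission
  imports Defs
begin

text \<open>The last coefficient is -1, so the last entry of a solution equals the weighted sum of
  the others. This trades lists for a function \<open>y\<close> on \<open>{1..k - 1}\<close>; list
  positions start at 0, hence the shift \<open>x ! (i - 1)\<close>.\<close>

lemma has_solution_in_rado_eqD:
  assumes "has_solution_in (rado_eq k b) A" and "k \<ge> 1"
  obtains y where "\<And>i. i \<in> {1..k - 1} \<Longrightarrow> y i \<in> A" and "(\<Sum>i = 1..k - 1. b i * y i) \<in> A"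
proof -
  obtain x where sol: "is_solution (rado_eq k b) x" and A: "set x \<subseteq> A"
    using assms(1) by (auto simp: has_solution_in_def)
  obtain n where k: "k = Suc n"
    using assms(2) by (cases k) auto
  have len: "length x = Suc n"
    using sol by (simp add: is_solution_def rado_eq_def k)
  have "(\<Sum>i<n. int (b (Suc i)) * int (x ! i)) - int (x ! n) = 0"
    using sol by (simp add: is_solution_def rado_eq_def k nth_append del: upt_Suc)
  then have "int (x ! n) = int (\<Sum>i<n. b (Suc i) * x ! i)"
    by simp
  then have eq: "x ! n = (\<Sum>i<n. b (Suc i) * x ! i)"
    by (simp only: of_nat_eq_iff)
  also have "\<dots> = (\<Sum>i = 1..n. b i * x ! (i - 1))"
    by (simp add: sum.atLeast1_atMost_eq)
  finally have eq: "(\<Sum>i = 1..k - 1. b i * x ! (i - 1)) = x ! n"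
    by (simp add: k)
  show thesis
  proof (rule that[of "\<lambda>i. x ! (i - 1)"])
    show "x ! (i - 1) \<in> A" if "i \<in> {1..k - 1}" for i
      using that A len k by (intro subsetD[OF A] nth_mem) auto
    show "(\<Sum>i = 1..k - 1. b i * x ! (i - 1)) \<in> A"
      unfolding eq using A len by (intro subsetD[OF A] nth_mem) auto
  qed
qed

text \<open>Split off the summand at \<open>j\<close>. Of its coefficient, \<open>t\<close> units
  each contribute at least \<open>H\<close> and the remaining \<open>c j - t\<close> at least 1
  each, as \<open>H\<close> is positive. Every other summand is at least its coefficient.\<close>

lemma weighted_sum_ge:
  fixes c y :: "'a \<Rightarrow> nat"
  assumes "finite I" and "j \<in> I" and "t \<le> c j" and "1 \<le> H" and "H \<le> y j"
    and "\<And>i. i \<in> I \<Longrightarrow> 1 \<le> y i"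
  shows "t * H + (sum c I - t) \<le> (\<Sum>i\<in>I. c i * y i)"
proof -
  have "sum c I = c j + sum c (I - {j})"
    using assms(1,2) by (rule sum.remove)
  moreover have "t * H + (c j - t) \<le> c j * y j"
  proof -
    have "t * H + (c j - t) \<le> t * H + (c j - t) * H"
      using assms(4) by simp
    also have "\<dots> = c j * H"
      using assms(3) by (simp flip: add_mult_distrib)
    also have "\<dots> \<le> c j * y j"
      using assms(5) by simp
    finally show ?thesis .
  qed
  moreover have "sum c (I - {j}) \<le> (\<Sum>i\<in>I - {j}. c i * y i)"
    using assms(6) by (intro sum_mono) auto
  moreover have "(\<Sum>i\<in>I. c i * y i) = c j * y j + (\<Sum>i\<in>I - {j}. c i * y i)"
    using assms(1,2) by (rule sum.remove)
  ultimately show ?thesis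
    using assms(3) by linarith
qed

theorem theorem2p1:
  fixes k l t q s :: nat and b c :: "nat \<Rightarrow> nat"
  assumes "k \<ge> 3" and "l \<ge> 3"
    and "\<And>i. i \<in> {1..k - 1} \<Longrightarrow> b i > 0"
    and "\<And>i. i \<in> {1..l - 1} \<Longrightarrow> c i > 0"
    and "b 1 = Min (b ` {1..k - 1})"
    and "c 1 = Min (c ` {1..l - 1})"
    and "t = b 1" and "t = c 1"
    and "q = (\<Sum>i = 2..k - 1. b i)"
    and "s = (\<Sum>i = 2..l - 1. c i)"
    and "q \<ge> s"
  shows "RR (rado_eq k b) (rado_eq l c) \<ge> enat (t * (t + q) * (t + s) + s)"
proof -
  define L where "L = t + s"
  define H where "H = (t + s) * (t + q)"
  have t: "t > 0"
    using assms(1,3,7) by simp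
  have sum_b: "(\<Sum>i = 1..k - 1. b i) = t + q"
    using assms(1,7,9) by (simp add: sum.atLeast_Suc_atMost numeral_2_eq_2)
  have sum_c: "(\<Sum>i = 1..l - 1. c i) = t + s"
    using assms(2,8,10) by (simp add: sum.atLeast_Suc_atMost numeral_2_eq_2)
  have c_ge: "t \<le> c i" if "i \<in> {1..l - 1}" for i
    using that assms(6,8) by simp
  have H: "1 \<le> H"
    using t by (simp add: H_def)
  have "t * H + s \<le> N" if RR: "RR_property (rado_eq k b) (rado_eq l c) N" for N
  proof (rule ccontr)
    assume "\<not> t * H + s \<le> N"
    then have N: "N < t * H + s" by simp
    define \<chi> where "\<chi> n \<longleftrightarrow> L \<le> n \<and> n < H" for n
    from RR have "has_solution_in (rado_eq k b) {n \<in> {1..N}. \<chi> n} \<or>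
        has_solution_in (rado_eq l c) {n \<in> {1..N}. \<not> \<chi> n}"
      unfolding RR_property_def by blast
    then show False
    proof
      assume "has_solution_in (rado_eq k b) {n \<in> {1..N}. \<chi> n}"
      then obtain y where y: "\<And>i. i \<in> {1..k - 1} \<Longrightarrow> y i \<in> {n \<in> {1..N}. \<chi> n}"
        and z: "(\<Sum>i = 1..k - 1. b i * y i) \<in> {n \<in> {1..N}. \<chi> n}"
        by (rule has_solution_in_rado_eqD) (use assms(1) in auto)
      \<comment> \<open>\<open>H\<close> is exactly the value of the sum when all entries equal
        \<open>L\<close>, the least number of the first colour.\<close>
      have "H = (\<Sum>i = 1..k - 1. b i * L)"
        unfolding sum_distrib_right[symmetric] sum_b H_def L_def by (rule mult.commute)
      also have "\<dots> \<le> (\<Sum>i = 1..k - 1. b i * y i)"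
        using y by (intro sum_mono mult_left_mono) (auto simp: \<chi>_def)
      finally show False
        using z by (simp add: \<chi>_def)
    next
      assume "has_solution_in (rado_eq l c) {n \<in> {1..N}. \<not> \<chi> n}"
      then obtain y where y: "\<And>i. i \<in> {1..l - 1} \<Longrightarrow> y i \<in> {n \<in> {1..N}. \<not> \<chi> n}"
        and z: "(\<Sum>i = 1..l - 1. c i * y i) \<in> {n \<in> {1..N}. \<not> \<chi> n}"
        by (rule has_solution_in_rado_eqD) (use assms(2) in auto)
      show False
      proof (cases "\<exists>j \<in> {1..l - 1}. H \<le> y j")
        case True
        then obtain j where j: "j \<in> {1..l - 1}" "H \<le> y j" by blast
        \<comment> \<open>By \<open>sum_c\<close> the left-hand side is \<open>t * H + s\<close>,
          which exceeds \<open>N\<close>.\<close>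
        have "t * H + ((\<Sum>i = 1..l - 1. c i) - t) \<le> (\<Sum>i = 1..l - 1. c i * y i)"
          using j c_ge H y by (intro weighted_sum_ge[of _ j]) auto
        then show False
          using z N unfolding sum_c by simp
      next
        case False
        \<comment> \<open>Numbers of the second colour lie below \<open>L\<close> or from
          \<open>H\<close> on, and the case assumption excludes the latter.\<close>
        then have small: "1 \<le> y i" "y i \<le> L - 1" if "i \<in> {1..l - 1}" for i
          using y[OF that] that by (auto simp: \<chi>_def not_le)
        have "(\<Sum>i = 1..l - 1. c i * 1) \<le> (\<Sum>i = 1..l - 1. c i * y i)"
          using small by (intro sum_mono mult_left_mono) auto
        then have "L \<le> (\<Sum>i = 1..l - 1. c i * y i)"
          by (simp only: mult_1_right sum_c L_def)
        moreover have "(\<Sum>i = 1..l - 1. c i * y i) < H"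
        proof -
          have "(\<Sum>i = 1..l - 1. c i * y i) \<le> (\<Sum>i = 1..l - 1. c i * (L - 1))"
            using small by (intro sum_mono mult_left_mono) auto
          also have "\<dots> = L * (L - 1)"
            unfolding sum_distrib_right[symmetric] sum_c L_def by (rule refl)
          \<comment> \<open>Here \<open>L - 1 < t + s \<le> t + q\<close>; strictness of both
            factors' bounds rests on \<open>t > 0\<close>.\<close>
          also have "\<dots> < L * (t + q)"
            using t assms(11) by (intro mult_strict_left_mono) (auto simp: L_def)
          finally show ?thesis
            by (simp add: H_def L_def)
        qed
        ultimately show False
          using z by (simp add: \<chi>_def)
      qed
    qed
  qed
  \<comment> \<open>A lower bound for every \<open>N\<close> with the property bounds the infimum;
    this includes the case of no such \<open>N\<close>, where the infimum is \<infinity>.\<close>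
  then have "enat (t * H + s) \<le> RR (rado_eq k b) (rado_eq l c)"
    unfolding RR_def by (intro Inf_greatest) auto
  then show ?thesis
    by (simp add: H_def mult_ac)
qed

end
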